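(* Let $M$ be a connected matroid, let $N$ be a binary matroid which is not a circuit (i.e., $E(N) \notin \mathcal{C}(N)$), and let $f: M \rightarrow N$ be a matroid homomorphism. Then $M$ is binary.
   Context: For a matroid $X$, $E(X)$ denotes its ground set and $\mathcal{C}(X)$ its set of circuits. A matroid homomorphism $f: M \rightarrow N$ is a map $f: E(M) \rightarrow E(N)$ from the ground set of $M$ onto the ground set of $N$ such that $f(C) \in \mathcal{C}(N)$ for every $C \in \mathcal{C}(M)$. *)

theory Defs
  imports Main "HOL-Library.Z2"
begin

locale matroid =
  fixes E :: "'a set" and indep :: "'a set \<Rightarrow> bool"
  assumes finite_ground: "finite E"
    and indep_subset_ground: "indep X \<Longrightarrow> X \<subseteq> E"
    and indep_empty: "indep {}"
    and indep_subset: "indep X \<Longrightarrow> Y \<subseteq> X \<Longrightarrow> indep Y"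
    and augment: "indep X \<Longrightarrow> indep Y \<Longrightarrow> card Y < card X \<Longrightarrow>
      \<exists>x \<in> X - Y. indep (insert x Y)"

definition circuits :: "'a set \<Rightarrow> ('a set \<Rightarrow> bool) \<Rightarrow> 'a set set" where
  "circuits E indep = {C. C \<subseteq> E \<and> \<not> indep C \<and> (\<forall>D. D \<subset> C \<longrightarrow> indep D)}"

definition connected_matroid :: "'a set \<Rightarrow> ('a set \<Rightarrow> bool) \<Rightarrow> bool" where
  "connected_matroid E indep \<longleftrightarrow>
    (\<forall>x \<in> E. \<forall>y \<in> E. x \<noteq> y \<longrightarrow> (\<exists>C \<in> circuits E indep. x \<in> C \<and> y \<in> C))"

text \<open>
  Linear independence over GF(2) of the family of columns with labels in \<open>X\<close> of the matrix
  \<open>A\<close> with rows \<open>0, \<dots>, r - 1\<close>; as a family, so that two equal columns with different labels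
  are dependent.
\<close>

definition columns_indep :: "nat \<Rightarrow> (nat \<Rightarrow> 'a \<Rightarrow> bit) \<Rightarrow> 'a set \<Rightarrow> bool" where
  "columns_indep r A X \<longleftrightarrow>
    (\<forall>c :: 'a \<Rightarrow> bit. (\<forall>i < r. (\<Sum>x \<in> X. c x * A i x) = 0) \<longrightarrow> (\<forall>x \<in> X. c x = 0))"

definition binary_matroid :: "'a set \<Rightarrow> ('a set \<Rightarrow> bool) \<Rightarrow> bool" where
  "binary_matroid E indep \<longleftrightarrow>
    (\<exists>r A. \<forall>X \<subseteq> E. indep X \<longleftrightarrow> columns_indep r A X)"

definition matroid_hom ::
  "('a \<Rightarrow> 'b) \<Rightarrow> 'a set \<Rightarrow> ('a set \<Rightarrow> bool) \<Rightarrow> 'b set \<Rightarrow> ('b set \<Rightarrow> bool) \<Rightarrow> bool" where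
  "matroid_hom f E indep E' indep' \<longleftrightarrow>
    f ` E = E' \<and> (\<forall>C \<in> circuits E indep. f ` C \<in> circuits E' indep')"

end

theory Submission
  imports Defs
begin

text \<open>
  A union \<open>L\<close> of circuits of nullity two is a line in the sense of Tutte: any two circuits inside
  \<open>L\<close> cover \<open>L\<close>. If \<open>M\<close> is not binary, some line \<open>L\<close> contains four circuits. If \<open>f(L)\<close> were not
  a circuit, the complements of their images in \<open>f(L)\<close> would be disjoint and nonempty, and the sum
  of two of the images would be a proper subset of a third, which is impossible in the binary
  matroid \<open>N\<close>. So \<open>D = f(L)\<close> is a circuit, and every circuit inside \<open>L\<close> maps onto it.

  If \<open>f(e) \<notin> D\<close> for some \<open>e\<close>, connectedness gives an ear of \<open>L\<close> containing \<open>e\<close>, and at least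
  three circuits run through this ear. Eliminating \<open>e\<close> from two of them leaves a circuit inside \<open>L\<close>,
  so their images together cover \<open>D\<close>. Hence the parts of \<open>D\<close> missed by the three images are disjoint
  and nonempty, while the sum of two of the images lies inside \<open>D\<close> and is therefore all of \<open>D\<close>: a
  contradiction. Thus \<open>E(N) = D\<close> is a circuit.
\<close>

section \<open>Cycles of a matrix over GF(2)\<close>

lemma sum_bit_sym_diff:
  fixes g :: "'a \<Rightarrow> bit"
  assumes "finite X" "finite Y"
  shows "sum g (sym_diff X Y) = sum g X + sum g Y"
proof -
  have "sum g X = sum g (X \<inter> Y) + sum g (X - Y)"
    using assms(1) by (rule sum.Int_Diff)
  moreover have "sum g Y = sum g (X \<inter> Y) + sum g (Y - X)"
    using sum.Int_Diff[OF assms(2), of g X] by (simp only: Int_commute)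
  ultimately have "sum g X + sum g Y
      = sum g (X - Y) + sum g (Y - X) + (sum g (X \<inter> Y) + sum g (X \<inter> Y))"
    by (simp only: ac_simps)
  also have "\<dots> = sum g (X - Y) + sum g (Y - X)"
    by simp
  also have "\<dots> = sum g (sym_diff X Y)"
    using assms by (intro sum.union_disjoint[symmetric]) auto
  finally show ?thesis by simp
qed

definition binary_cycle :: "nat \<Rightarrow> (nat \<Rightarrow> 'a \<Rightarrow> bit) \<Rightarrow> 'a set \<Rightarrow> bool" where
  "binary_cycle r A Z \<longleftrightarrow> (\<forall>i<r. (\<Sum>x\<in>Z. A i x) = 0)"

lemma binary_cycle_sym_diff:
  assumes "finite X" "finite Y" "binary_cycle r A X" "binary_cycle r A Y"
  shows "binary_cycle r A (sym_diff X Y)"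
  using assms by (simp add: binary_cycle_def sum_bit_sym_diff)

lemma binary_cycle_of_bool_iff:
  assumes b: "bij_betw b {0..<r} B" and "finite Z"
  shows "binary_cycle r (\<lambda>i x. of_bool (R (b i) x)) Z \<longleftrightarrow> (\<forall>y\<in>B. even (card (Z \<inter> {x. R y x})))"
proof -
  have "of_nat n = (0 :: bit) \<longleftrightarrow> even n" for n
    by (simp only: Z2.bit_eq_iff even_of_nat even_zero simp_thms)
  moreover have "(\<forall>i<r. Q (b i)) \<longleftrightarrow> (\<forall>y\<in>B. Q y)" for Q
    using bij_betw_imp_surj_on[OF b] by force
  ultimately show ?thesis using \<open>finite Z\<close> by (simp add: binary_cycle_def)
qed

lemma columns_indep_iff_binary_cycle:
  assumes "finite X"
  shows "columns_indep r A X \<longleftrightarrow> (\<forall>Z\<subseteq>X. binary_cycle r A Z \<longrightarrow> Z = {})"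
proof
  assume indep: "columns_indep r A X"
  show "\<forall>Z\<subseteq>X. binary_cycle r A Z \<longrightarrow> Z = {}"
  proof (intro allI impI)
    fix Z assume Z: "Z \<subseteq> X" "binary_cycle r A Z"
    have "(\<Sum>x\<in>X. of_bool (x \<in> Z) * A i x) = (\<Sum>x\<in>Z. A i x)" for i
      by (rule sum.mono_neutral_cong_right) (use assms Z in auto)
    then have "\<forall>x\<in>X. of_bool (x \<in> Z) = (0 :: bit)"
      using indep[unfolded columns_indep_def, rule_format, of "\<lambda>x. of_bool (x \<in> Z)"] Z(2)
      by (simp add: binary_cycle_def)
    then show "Z = {}" using Z(1) by auto
  qed
next
  assume acyclic: "\<forall>Z\<subseteq>X. binary_cycle r A Z \<longrightarrow> Z = {}"
  show "columns_indep r A X"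
    unfolding columns_indep_def
  proof (intro allI impI)
    fix c :: "'a \<Rightarrow> bit" assume c: "\<forall>i<r. (\<Sum>x\<in>X. c x * A i x) = 0"
    let ?Z = "{x \<in> X. c x \<noteq> 0}"
    have "(\<Sum>x\<in>X. c x * A i x) = (\<Sum>x\<in>?Z. A i x)" for i
      by (rule sum.mono_neutral_cong_right) (use assms in auto)
    then have "binary_cycle r A ?Z" using c by (simp add: binary_cycle_def)
    moreover have "?Z \<subseteq> X" by blast
    ultimately have "?Z = {}" using acyclic by metis
    then show "\<forall>x\<in>X. c x = 0" by blast
  qed
qed

lemma columns_indep_subset:
  assumes "finite X" "columns_indep r A X" "Y \<subseteq> X"
  shows "columns_indep r A Y"
proof -
  have "\<forall>Z\<subseteq>Y. binary_cycle r A Z \<longrightarrow> Z = {}"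
    using assms columns_indep_iff_binary_cycle[OF assms(1)] by (meson subset_trans)
  then show ?thesis
    using columns_indep_iff_binary_cycle finite_subset[OF assms(3,1)] by blast
qed

lemma columns_indep_exchange:
  assumes "finite B" "columns_indep r A B"
    and C: "binary_cycle r A C" "C \<subseteq> insert e B" "e \<in> C" "x \<in> C" "x \<noteq> e"
  shows "columns_indep r A (insert e (B - {x}))"
proof -
  have acyclic: "Z = {}" if "Z \<subseteq> B" "binary_cycle r A Z" for Z
    using assms(1,2) columns_indep_iff_binary_cycle that by blast
  have "Z = {}" if Z: "Z \<subseteq> insert e (B - {x})" "binary_cycle r A Z" for Z
  proof (cases "e \<in> Z")
    case True
    have finite: "finite Z" "finite C"
      using Z(1) C(2) assms(1) finite_subset by blast+
    have "sym_diff Z C \<subseteq> B" using Z(1) C(2,3) True by blast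
    then have "sym_diff Z C = {}"
      using acyclic binary_cycle_sym_diff[OF finite Z(2) C(1)] by blast
    moreover have "x \<in> C - Z" using Z(1) C(4,5) by blast
    ultimately show ?thesis by blast
  next
    case False
    then have "Z \<subseteq> B" using Z(1) by blast
    then show ?thesis using acyclic Z(2) by blast
  qed
  then show ?thesis
    using columns_indep_iff_binary_cycle[of "insert e (B - {x})"] assms(1) by blast
qed

section \<open>Circuits and bases\<close>

context matroid
begin

abbreviation circuit :: "'a set \<Rightarrow> bool" where
  "circuit C \<equiv> C \<in> circuits E indep"

definition circuits_in :: "'a set \<Rightarrow> 'a set set" where
  "circuits_in L = {C. circuit C \<and> C \<subseteq> L}"

lemma indep_finite: "indep X \<Longrightarrow> finite X"
  using finite_ground finite_subset indep_subset_ground by blast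

lemma circuit_subset_ground: "circuit C \<Longrightarrow> C \<subseteq> E"
  by (simp add: circuits_def)

lemma circuit_finite: "circuit C \<Longrightarrow> finite C"
  using circuit_subset_ground finite_ground finite_subset by blast

lemma circuit_not_subset_indep: "circuit C \<Longrightarrow> indep I \<Longrightarrow> \<not> C \<subseteq> I"
  using indep_subset by (auto simp: circuits_def)

lemma circuit_psubset_indep: "circuit C \<Longrightarrow> X \<subset> C \<Longrightarrow> indep X"
  by (simp add: circuits_def)

lemma circuit_nonempty: "circuit C \<Longrightarrow> C \<noteq> {}"
  using indep_empty by (auto simp: circuits_def)

lemma circuit_subset_eq: "circuit C \<Longrightarrow> circuit D \<Longrightarrow> C \<subseteq> D \<Longrightarrow> C = D"
  by (auto simp: circuits_def)

lemma dependent_contains_circuit: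
  assumes "X \<subseteq> E" "\<not> indep X"
  obtains C where "circuit C" "C \<subseteq> X"
proof -
  let ?F = "{D. D \<subseteq> X \<and> \<not> indep D}"
  have "finite ?F" using assms(1) finite_ground by (simp add: finite_subset)
  moreover have "X \<in> ?F" using assms(2) by blast
  ultimately obtain C where C: "C \<in> ?F" "\<forall>D\<in>?F. D \<subseteq> C \<longrightarrow> C = D"
    by (meson finite_has_minimal2)
  then have "indep D" if "D \<subset> C" for D
    using that by blast
  then have "circuit C" using C(1) assms(1) by (auto simp: circuits_def)
  then show ?thesis using that C(1) by blast
qed

definition basis_in :: "'a set \<Rightarrow> 'a set \<Rightarrow> bool" where
  "basis_in S I \<longleftrightarrow> I \<subseteq> S \<and> indep I \<and> (\<forall>x\<in>S - I. \<not> indep (insert x I))"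

abbreviation base :: "'a set \<Rightarrow> bool" where
  "base \<equiv> basis_in E"

lemma basis_in_indep: "basis_in S I \<Longrightarrow> indep I"
  by (simp add: basis_in_def)

lemma basis_in_subset: "basis_in S I \<Longrightarrow> I \<subseteq> S"
  by (simp add: basis_in_def)

lemma indep_extends_to_basis_in:
  assumes "indep I" "I \<subseteq> S"
  obtains J where "basis_in S J" "I \<subseteq> J"
proof -
  let ?F = "{J. J \<subseteq> S \<and> indep J}"
  have "finite ?F"
    by (rule finite_subset[of _ "Pow E"]) (use indep_subset_ground finite_ground in auto)
  moreover have "I \<in> ?F" using assms by blast
  ultimately obtain J where J: "J \<in> ?F" "I \<subseteq> J" "\<forall>K\<in>?F. J \<subseteq> K \<longrightarrow> J = K"
    by (meson finite_has_maximal2)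
  then have "\<not> indep (insert x J)" if "x \<in> S - J" for x
    using that bspec[OF J(3), of "insert x J"] by blast
  then have "basis_in S J" using J(1) by (simp add: basis_in_def)
  then show ?thesis using that J(2) by blast
qed

lemma card_le_basis_in:
  assumes "indep I" "I \<subseteq> S" "basis_in S J"
  shows "card I \<le> card J"
proof (rule ccontr)
  assume "\<not> ?thesis"
  then obtain x where "x \<in> I - J" "indep (insert x J)"
    using augment[OF assms(1) basis_in_indep[OF assms(3)]] by auto
  then show False using assms(2,3) by (auto simp: basis_in_def)
qed

lemma basis_in_card_eq: "basis_in S I \<Longrightarrow> basis_in S J \<Longrightarrow> card I = card J"
  by (meson basis_in_indep basis_in_subset card_le_basis_in le_antisym)

lemma basis_in_if_card_eq:
  assumes "indep I" "I \<subseteq> S" "basis_in S J" "card I = card J"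
  shows "basis_in S I"
proof -
  have "\<not> indep (insert x I)" if "x \<in> S - I" for x
    using card_le_basis_in[of "insert x I" S J] assms that indep_finite[of I] by auto
  then show ?thesis using assms(1,2) by (simp add: basis_in_def)
qed

lemma basis_in_insert_if_circuit:
  assumes I: "basis_in S I" and C: "circuit C" "C \<subseteq> insert e S" "e \<in> C"
  shows "basis_in (insert e S) I"
proof -
  have "indep (C - {e})" "C - {e} \<subseteq> S" using C by (auto intro: circuit_psubset_indep)
  then obtain J where J: "basis_in S J" "C - {e} \<subseteq> J"
    by (rule indep_extends_to_basis_in)
  have "\<not> indep (insert e J)" using circuit_not_subset_indep[OF C(1)] J(2) by blast
  then have "basis_in (insert e S) J" using J(1) by (auto simp: basis_in_def)
  then show ?thesis
    using basis_in_if_card_eq[OF basis_in_indep[OF I]] basis_in_card_eq[OF I J(1)]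
      basis_in_subset[OF I] by blast
qed

text \<open>A basis of \<open>S = C1 \<union> C2 - {e, h}\<close> stays one when first \<open>e\<close>, via \<open>C2\<close>, and then \<open>h\<close>, via
  \<open>C1\<close>, is added to \<open>S\<close>.\<close>

lemma strong_circuit_elimination:
  assumes C1: "circuit C1" and C2: "circuit C2" and e: "e \<in> C1 \<inter> C2" and h: "h \<in> C1 - C2"
  obtains C where "circuit C" "C \<subseteq> C1 \<union> C2 - {e}" "h \<in> C"
proof -
  let ?S = "C1 \<union> C2 - {e, h}"
  obtain I where I: "basis_in ?S I"
    using indep_extends_to_basis_in[OF indep_empty empty_subsetI] .
  then have "basis_in (insert e ?S) I"
    using C2 e h by (auto intro: basis_in_insert_if_circuit)
  then have "basis_in (insert h (insert e ?S)) I"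
    using C1 e h by (auto intro: basis_in_insert_if_circuit)
  then have "\<not> indep (insert h I)"
    using basis_in_subset[OF I] by (auto simp: basis_in_def)
  moreover have "insert h I \<subseteq> E"
    using basis_in_subset[OF I] C1 C2 h circuit_subset_ground by blast
  ultimately obtain C where C: "circuit C" "C \<subseteq> insert h I"
    using dependent_contains_circuit by blast
  have "h \<in> C" using C circuit_not_subset_indep[OF C(1) basis_in_indep[OF I]] by blast
  moreover have "C \<subseteq> C1 \<union> C2 - {e}" using C(2) basis_in_subset[OF I] e h by blast
  ultimately show ?thesis using that C(1) by blast
qed

lemma circuit_elimination:
  assumes "circuit C" "circuit D" "C \<noteq> D" "e \<in> C \<inter> D"
  obtains X where "circuit X" "X \<subseteq> C \<union> D - {e}"
proof -
  obtain h where "h \<in> C - D" using assms(1-3) circuit_subset_eq by blast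
  then show ?thesis using strong_circuit_elimination[OF assms(1,2,4)] that by blast
qed

lemma unique_circuit_insert:
  assumes "indep I" "circuit C" "circuit D" "C \<subseteq> insert e I" "D \<subseteq> insert e I"
  shows "C = D"
proof (rule ccontr)
  assume "C \<noteq> D"
  moreover have "e \<in> C \<inter> D" using assms circuit_not_subset_indep by blast
  ultimately obtain X where "circuit X" "X \<subseteq> C \<union> D - {e}"
    using circuit_elimination assms(2,3) by metis
  then show False using assms circuit_not_subset_indep[of X I] by blast
qed

lemma indep_insert_Diff_if_mem_circuit:
  assumes I: "indep I" and C: "circuit C" "C \<subseteq> insert e I" and y: "y \<in> C"
  shows "indep (insert e I - {y})"
proof (rule ccontr)
  have "insert e I \<subseteq> E"
    using C I circuit_not_subset_indep circuit_subset_ground indep_subset_ground by blast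
  moreover assume "\<not> ?thesis"
  ultimately obtain D where D: "circuit D" "D \<subseteq> insert e I - {y}"
    using dependent_contains_circuit[of "insert e I - {y}"] by blast
  then have "D = C" using unique_circuit_insert[OF I D(1) C(1) _ C(2)] by blast
  then show False using D(2) y by blast
qed

lemma fundamental_circuit:
  assumes "base B" "e \<in> E - B"
  obtains C where "circuit C" "C \<subseteq> insert e B" "e \<in> C"
proof -
  have "insert e B \<subseteq> E" "\<not> indep (insert e B)"
    using assms by (auto simp: basis_in_def)
  then obtain C where C: "circuit C" "C \<subseteq> insert e B"
    using dependent_contains_circuit by blast
  then have "e \<in> C"
    using circuit_not_subset_indep[OF C(1) basis_in_indep[OF assms(1)]] by blast
  then show ?thesis using that C by blast
qed

lemma base_swap_iff_mem_circuit:
  assumes B: "base B" "e \<notin> B" "x \<in> B" and C: "circuit C" "C \<subseteq> insert e B"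
  shows "base (insert e (B - {x})) \<longleftrightarrow> x \<in> C"
proof
  assume "base (insert e (B - {x}))"
  then have "\<not> C \<subseteq> insert e (B - {x})"
    using circuit_not_subset_indep[OF C(1)] basis_in_indep by blast
  then show "x \<in> C" using C(2) by blast
next
  assume "x \<in> C"
  then have "indep (insert e B - {x})"
    using indep_insert_Diff_if_mem_circuit[OF basis_in_indep[OF B(1)] C] by blast
  moreover have "insert e B - {x} = insert e (B - {x})" using B(2,3) by blast
  ultimately have indep: "indep (insert e (B - {x}))" by simp
  have "card (insert e (B - {x})) = card B"
    using B card_Suc_Diff1[of B x] indep_finite[OF basis_in_indep[OF B(1)]] by simp
  then show "base (insert e (B - {x}))"
    using basis_in_if_card_eq[OF indep indep_subset_ground[OF indep] B(1)] by blast
qed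

lemma base_swap_mem_iff:
  assumes "base B" "x \<in> B" "y \<in> B"
  shows "base (insert x (B - {y})) \<longleftrightarrow> x = y"
proof
  assume "base (insert x (B - {y}))"
  then have "card (insert x (B - {y})) = card B" by (rule basis_in_card_eq) (rule assms(1))
  then have "insert x (B - {y}) = B"
    using assms indep_finite[OF basis_in_indep[OF assms(1)]] by (intro card_subset_eq) auto
  then have "y \<in> insert x (B - {y})" using assms(3) by simp
  then show "x = y" by simp
next
  assume "x = y"
  then show "base (insert x (B - {y}))" using assms by (simp add: insert_absorb)
qed

lemma base_exchange:
  assumes B: "base B" "base B'" and x: "x \<in> B - B'"
  obtains e where "e \<in> B' - B" "base (insert e (B - {x}))"
proof -
  have finite: "finite B" using B(1) basis_in_indep indep_finite by blast
  have "indep (B - {x})" using B(1) basis_in_indep indep_subset by blast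
  moreover have card: "Suc (card (B - {x})) = card B"
    using card_Suc_Diff1[OF finite] x by blast
  then have "card (B - {x}) < card B'"
    using basis_in_card_eq[OF B] by simp
  ultimately obtain e where e: "e \<in> B' - (B - {x})" "indep (insert e (B - {x}))"
    using augment[OF basis_in_indep[OF B(2)]] by blast
  then have "card (insert e (B - {x})) = card B" using card finite by simp
  then have "base (insert e (B - {x}))"
    using basis_in_if_card_eq[OF e(2) indep_subset_ground[OF e(2)] B(1)] by blast
  moreover have "e \<in> B' - B" using e(1) x by blast
  ultimately show ?thesis using that by blast
qed

lemma base_exchange_induct [consumes 2, case_names init exchange]:
  assumes "base B0" "base B"
    and init: "P B0"
    and exchange: "\<And>B e x. base B \<Longrightarrow> P B \<Longrightarrow> e \<notin> B \<Longrightarrow> x \<in> B \<Longrightarrow> base (insert e (B - {x})) \<Longrightarrow>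
      P (insert e (B - {x}))"
  shows "P B"
  using \<open>base B\<close>
proof (induction "card (B - B0)" arbitrary: B rule: less_induct)
  case less
  have finite: "finite B" "finite B0"
    using less.prems \<open>base B0\<close> basis_in_indep indep_finite by blast+
  show ?case
  proof (cases "B \<subseteq> B0")
    case True
    then have "B = B0"
      using basis_in_card_eq[OF less.prems \<open>base B0\<close>] finite(2) by (simp add: card_subset_eq)
    then show ?thesis using init by simp
  next
    case False
    then obtain x where x: "x \<in> B - B0" by blast
    obtain e where e: "e \<in> B0 - B" and base: "base (insert e (B - {x}))"
      using base_exchange[OF less.prems \<open>base B0\<close> x] .
    let ?B = "insert e (B - {x})"
    have "?B - B0 = B - B0 - {x}" using e by blast
    then have "?B - B0 \<subset> B - B0" using x by blast
    then have "card (?B - B0) < card (B - B0)" using finite(1) by (simp add: psubset_card_mono)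
    then have "P ?B" using less.hyps base by blast
    moreover have "insert x (?B - {e}) = B" using e x by blast
    ultimately show ?thesis using exchange[OF base, of x e] less.prems e x by auto
  qed
qed

section \<open>Binary matroids and Tutte's lines\<close>

lemma binary_sym_diff_dependent:
  assumes "binary_matroid E indep" and C: "circuit C" "circuit D" "C \<noteq> D"
  shows "\<not> indep (sym_diff C D)"
proof -
  obtain r A where A: "\<And>X. X \<subseteq> E \<Longrightarrow> indep X \<longleftrightarrow> columns_indep r A X"
    using assms(1) unfolding binary_matroid_def by blast
  have indep_iff: "indep X \<longleftrightarrow> (\<forall>Z\<subseteq>X. binary_cycle r A Z \<longrightarrow> Z = {})" if "X \<subseteq> E" for X
    using A[OF that] columns_indep_iff_binary_cycle[OF finite_subset[OF that finite_ground]]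
    by simp
  have cycle: "binary_cycle r A C" if C: "circuit C" for C
  proof -
    obtain Z where Z: "Z \<subseteq> C" "Z \<noteq> {}" "binary_cycle r A Z"
      using indep_iff[OF circuit_subset_ground[OF C]] circuit_not_subset_indep[OF C] by blast
    then have "\<not> indep Z"
      using indep_iff[of Z] circuit_subset_ground[OF C] by blast
    then have "Z = C" using Z(1) circuit_psubset_indep[OF C] by blast
    then show ?thesis using Z(3) by simp
  qed
  have "binary_cycle r A (sym_diff C D)"
    using C by (intro binary_cycle_sym_diff circuit_finite cycle)
  moreover have "sym_diff C D \<subseteq> E" using C circuit_subset_ground by blast
  moreover have "sym_diff C D \<noteq> {}" using C by blast
  ultimately show ?thesis using indep_iff by blast
qed

lemma binary_circuit_covered:
  assumes binary: "binary_matroid E indep" and circuits: "circuit D" "circuit X" "circuit Y"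
    and sym_diff: "sym_diff X Y \<subseteq> D"
    and cover: "D \<subseteq> X \<union> Y" "D \<subseteq> X \<union> Z" "D \<subseteq> Y \<union> Z"
  shows "D \<subseteq> X \<or> D \<subseteq> Z"
proof (cases "X = Y")
  case True
  then show ?thesis using cover(1) by blast
next
  case False
  then have "\<not> indep (sym_diff X Y)"
    using binary_sym_diff_dependent[OF binary circuits(2,3)] by blast
  then have "D = sym_diff X Y"
    using circuit_psubset_indep[OF circuits(1)] sym_diff by blast
  then show ?thesis using cover(2,3) by blast
qed

text \<open>Equivalently, \<open>L\<close> is a union of circuits and has nullity two.\<close>

definition tutte_line :: "'a set \<Rightarrow> bool" where
  "tutte_line L \<longleftrightarrow> (\<exists>C\<in>circuits_in L. \<exists>D\<in>circuits_in L. C \<noteq> D) \<and>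
    pairwise (\<lambda>C D. C \<union> D = L) (circuits_in L)"

lemma tutte_line_Un:
  "tutte_line L \<Longrightarrow> C \<in> circuits_in L \<Longrightarrow> D \<in> circuits_in L \<Longrightarrow> C \<noteq> D \<Longrightarrow> C \<union> D = L"
  by (auto simp: tutte_line_def dest: pairwiseD)

lemma tutte_line_subset_ground:
  assumes L: "tutte_line L"
  shows "L \<subseteq> E"
proof -
  obtain C D where "C \<in> circuits_in L" "D \<in> circuits_in L" "C \<noteq> D"
    using L by (auto simp: tutte_line_def)
  moreover from this have "L = C \<union> D" using tutte_line_Un[OF L] by blast
  ultimately show ?thesis using circuit_subset_ground by (simp add: circuits_in_def)
qed

lemma tutte_line_Un_circuits:
  assumes I: "indep I" and C: "circuit C" "C \<subseteq> insert e I" and D: "circuit D" "D \<subseteq> insert g I"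
    and ne: "C \<noteq> D"
  shows "tutte_line (C \<union> D)"
proof -
  have cover: "C' \<subseteq> X \<union> Y"
    if C': "circuit C'" "C' \<subseteq> insert e' I" "C \<union> D \<subseteq> insert g' (insert e' I)"
      and X: "X \<in> circuits_in (C \<union> D)" and Y: "Y \<in> circuits_in (C \<union> D)" and "X \<noteq> Y"
    for C' e' g' X Y
  proof
    fix y assume "y \<in> C'"
    then have indep: "indep (insert e' I - {y})"
      using indep_insert_Diff_if_mem_circuit[OF I C'(1,2)] by blast
    show "y \<in> X \<union> Y"
    proof (rule ccontr)
      assume "y \<notin> X \<union> Y"
      then have "X \<subseteq> insert g' (insert e' I - {y})" "Y \<subseteq> insert g' (insert e' I - {y})"
        using X Y C'(3) by (auto simp: circuits_in_def)
      then have "X = Y"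
        using unique_circuit_insert[OF indep] X Y by (auto simp: circuits_in_def)
      then show False using \<open>X \<noteq> Y\<close> by contradiction
    qed
  qed
  have "X \<union> Y = C \<union> D" if "X \<in> circuits_in (C \<union> D)" "Y \<in> circuits_in (C \<union> D)" "X \<noteq> Y" for X Y
  proof -
    have "C \<subseteq> X \<union> Y" using C D that by (intro cover[of C e g]) auto
    moreover have "D \<subseteq> X \<union> Y" using C D that by (intro cover[of D g e]) auto
    ultimately show ?thesis using that by (auto simp: circuits_in_def)
  qed
  moreover have "C \<in> circuits_in (C \<union> D)" "D \<in> circuits_in (C \<union> D)"
    using C D by (auto simp: circuits_in_def)
  ultimately show ?thesis using ne unfolding tutte_line_def pairwise_def by blast
qed

lemma tutte_line_circuit_sym_diff:
  assumes line: "tutte_line (C \<union> D)" and C: "circuit C" "circuit D" "C \<inter> D \<noteq> {}"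
    and dependent: "\<not> indep (sym_diff C D)"
  shows "circuit (sym_diff C D)"
proof -
  have "sym_diff C D \<subseteq> E" using C(1,2) circuit_subset_ground by blast
  then obtain X where X: "circuit X" "X \<subseteq> sym_diff C D"
    using dependent dependent_contains_circuit by blast
  have "C \<in> circuits_in (C \<union> D)" "D \<in> circuits_in (C \<union> D)" "X \<in> circuits_in (C \<union> D)"
    using C X by (auto simp: circuits_in_def)
  moreover have "X \<noteq> C" "X \<noteq> D" using C(3) X(2) by blast+
  ultimately have "X \<union> C = C \<union> D" "X \<union> D = C \<union> D" using tutte_line_Un[OF line] by blast+
  then have "X = sym_diff C D" using X(2) by blast
  then show ?thesis using X(1) by simp
qed

lemma circuit_after_exchange_eq_sym_diff:
  assumes indep: "indep I" "indep (insert e (I - {x}))"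
    and C: "circuit C" "C \<subseteq> insert e I" "x \<in> C" and G: "circuit G" "G \<subseteq> insert g I" "x \<in> G"
    and ne: "C \<noteq> G" and dependent: "\<not> indep (sym_diff C G)"
    and D: "circuit D" "D \<subseteq> insert g (insert e (I - {x}))"
  shows "D = sym_diff C G"
proof -
  have "tutte_line (C \<union> G)"
    using tutte_line_Un_circuits[OF indep(1) C(1,2) G(1,2) ne] .
  then have "circuit (sym_diff C G)"
    using tutte_line_circuit_sym_diff C(1,3) G(1,3) dependent by blast
  moreover have "sym_diff C G \<subseteq> insert g (insert e (I - {x}))"
    using C(2,3) G(2,3) by blast
  ultimately show ?thesis
    using unique_circuit_insert[OF indep(2) D(1) _ D(2)] by blast
qed

definition represents_at :: "nat \<Rightarrow> (nat \<Rightarrow> 'a \<Rightarrow> bit) \<Rightarrow> 'a set \<Rightarrow> bool" where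
  "represents_at r A B \<longleftrightarrow> columns_indep r A B \<and>
    (\<forall>C e. circuit C \<longrightarrow> C \<subseteq> insert e B \<longrightarrow> binary_cycle r A C)"

lemma represents_atD:
  assumes "represents_at r A B"
  shows "columns_indep r A B"
    and "circuit C \<Longrightarrow> C \<subseteq> insert e B \<Longrightarrow> binary_cycle r A C"
  using assms by (auto simp: represents_at_def)

lemma binary_matroid_if_represents_at_bases:
  assumes "\<And>B. base B \<Longrightarrow> represents_at r A B"
  shows "binary_matroid E indep"
proof -
  have "indep X \<longleftrightarrow> columns_indep r A X" if X: "X \<subseteq> E" for X
  proof
    assume "indep X"
    then obtain B where B: "base B" "X \<subseteq> B"
      using indep_extends_to_basis_in X by blast
    then show "columns_indep r A X"
      using columns_indep_subset indep_finite[OF basis_in_indep[OF B(1)]]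
        represents_atD(1)[OF assms[OF B(1)]] by blast
  next
    assume acyclic: "columns_indep r A X"
    show "indep X"
    proof (rule ccontr)
      assume "\<not> indep X"
      then obtain C where C: "circuit C" "C \<subseteq> X"
        using dependent_contains_circuit X by blast
      obtain e where e: "e \<in> C" using circuit_nonempty[OF C(1)] by blast
      then have "indep (C - {e})" "C - {e} \<subseteq> E"
        using circuit_psubset_indep[OF C(1)] circuit_subset_ground[OF C(1)] by blast+
      then obtain B where B: "base B" "C - {e} \<subseteq> B"
        by (rule indep_extends_to_basis_in)
      then have "binary_cycle r A C"
        using represents_atD(2)[OF assms[OF B(1)] C(1), of e] by blast
      then have "C = {}"
        using acyclic columns_indep_iff_binary_cycle[OF finite_subset[OF X finite_ground]] C(2)
        by blast
      then show False using e by blast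
    qed
  qed
  then show ?thesis unfolding binary_matroid_def by blast
qed

text \<open>The column of \<open>x\<close> lists the \<open>y \<in> B\<close> that \<open>x\<close> can replace: the other elements of the
  fundamental circuit of \<open>x\<close> if \<open>x \<notin> B\<close>, and \<open>x\<close> itself if \<open>x \<in> B\<close>.\<close>

lemma ex_represents_at:
  assumes B: "base B"
  shows "\<exists>r A. represents_at r A B"
proof -
  have finite: "finite B" using B basis_in_indep indep_finite by blast
  then obtain b where b: "bij_betw b {0..<card B} B"
    using ex_bij_betw_nat_finite by blast
  define row where "row y = {x. base (insert x (B - {y}))}" for y
  define A :: "nat \<Rightarrow> 'a \<Rightarrow> bit" where "A i x = of_bool (base (insert x (B - {b i})))" for i x
  have cycle_iff: "binary_cycle (card B) A Z \<longleftrightarrow> (\<forall>y\<in>B. even (card (Z \<inter> row y)))"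
    if "finite Z" for Z
    unfolding A_def row_def using binary_cycle_of_bool_iff[OF b that] .
  have row: "x \<in> row y \<longleftrightarrow> x = y" if "x \<in> B" "y \<in> B" for x y
    using base_swap_mem_iff[OF B that] by (simp add: row_def)
  have "Z = {}" if Z: "Z \<subseteq> B" "binary_cycle (card B) A Z" for Z
  proof (rule ccontr)
    assume "Z \<noteq> {}"
    then obtain z where z: "z \<in> Z" by blast
    then have "Z \<inter> row z = {z}" using row Z(1) by blast
    then have "odd (card (Z \<inter> row z))" by simp
    then show False using Z z cycle_iff[OF finite_subset[OF Z(1) finite]] by blast
  qed
  then have "columns_indep (card B) A B"
    using columns_indep_iff_binary_cycle[OF finite] by blast
  moreover have "binary_cycle (card B) A C" if C: "circuit C" "C \<subseteq> insert e B" for C e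
  proof -
    have e: "e \<in> C" "e \<notin> B"
      using C circuit_not_subset_indep[OF C(1) basis_in_indep[OF B]] by blast+
    have "even (card (C \<inter> row y))" if y: "y \<in> B" for y
    proof -
      have "e \<in> row y \<longleftrightarrow> y \<in> C"
        using base_swap_iff_mem_circuit[OF B e(2) y C] by (simp add: row_def)
      then have "C \<inter> row y = (if y \<in> C then {e, y} else {})"
        using row[OF _ y] C(2) e y by auto
      moreover have "e \<noteq> y" using e(2) y by blast
      ultimately show ?thesis by simp
    qed
    then show ?thesis using cycle_iff[OF circuit_finite[OF C(1)]] by blast
  qed
  ultimately show ?thesis unfolding represents_at_def by blast
qed

lemma represents_at_exchange:
  assumes lines: "\<And>C D. circuit C \<Longrightarrow> circuit D \<Longrightarrow> C \<noteq> D \<Longrightarrow> tutte_line (C \<union> D) \<Longrightarrow>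
      \<not> indep (sym_diff C D)"
    and B: "base B" "represents_at r A B" and e: "e \<notin> B" and x: "x \<in> B"
    and B': "base (insert e (B - {x}))"
  shows "represents_at r A (insert e (B - {x}))"
proof -
  note indep = basis_in_indep[OF B(1)] and indep' = basis_in_indep[OF B']
  have "e \<in> E - B" using basis_in_subset[OF B'] e by blast
  then obtain C where C: "circuit C" "C \<subseteq> insert e B" "e \<in> C"
    using fundamental_circuit[OF B(1)] by blast
  have xC: "x \<in> C" using base_swap_iff_mem_circuit[OF B(1) e x C(1,2)] B' by blast
  note cycle = represents_atD(2)[OF B(2)]
  have "binary_cycle r A D" if D: "circuit D" "D \<subseteq> insert g (insert e (B - {x}))" for D g
  proof (cases "D \<subseteq> insert e B \<or> D \<subseteq> insert g B")
    case True
    then show ?thesis using cycle D(1) by blast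
  next
    case False
    then have "g \<in> E - B" using D circuit_subset_ground by blast
    then obtain G where G: "circuit G" "G \<subseteq> insert g B" "g \<in> G"
      using fundamental_circuit[OF B(1)] by blast
    have "x \<in> G"
    proof (rule ccontr)
      assume "x \<notin> G"
      then have "D = G" using unique_circuit_insert[OF indep' D(1) G(1) D(2)] G(2) by blast
      then show False using False G(2) by blast
    qed
    have "C \<noteq> G" using C(2,3) G(2) e False D by blast
    have "\<not> indep (sym_diff C G)"
      using lines[OF C(1) G(1) \<open>C \<noteq> G\<close>] tutte_line_Un_circuits[OF indep C(1,2) G(1,2) \<open>C \<noteq> G\<close>]
      by blast
    then have "D = sym_diff C G"
      using circuit_after_exchange_eq_sym_diff[OF indep indep' C(1,2) xC G(1,2) \<open>x \<in> G\<close> \<open>C \<noteq> G\<close> _ D]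
      by blast
    then show ?thesis
      using binary_cycle_sym_diff cycle C(1,2) G(1,2) circuit_finite by metis
  qed
  moreover have "columns_indep r A (insert e (B - {x}))"
    using columns_indep_exchange[OF indep_finite[OF indep] represents_atD(1)[OF B(2)]
        cycle[OF C(1,2)] C(2,3) xC] e x by blast
  ultimately show ?thesis unfolding represents_at_def by blast
qed

lemma binary_matroid_if_line_sym_diff_dependent:
  assumes "\<And>C D. circuit C \<Longrightarrow> circuit D \<Longrightarrow> C \<noteq> D \<Longrightarrow> tutte_line (C \<union> D) \<Longrightarrow>
    \<not> indep (sym_diff C D)"
  shows "binary_matroid E indep"
proof -
  obtain B0 where B0: "base B0"
    using indep_extends_to_basis_in[OF indep_empty empty_subsetI] .
  obtain r A where A: "represents_at r A B0" using ex_represents_at[OF B0] by blast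
  have "represents_at r A B" if "base B" for B
    using B0 that
  proof (induction rule: base_exchange_induct)
    case init
    show ?case by (rule A)
  next
    case (exchange B e x)
    show ?case by (rule represents_at_exchange) (fact assms exchange)+
  qed
  then show ?thesis by (rule binary_matroid_if_represents_at_bases)
qed

lemma nonbinary_line_four_circuits:
  assumes "\<not> binary_matroid E indep"
  obtains L C1 C2 C3 C4 where "tutte_line L" "{C1, C2, C3, C4} \<subseteq> circuits_in L"
    "distinct [C1, C2, C3, C4]"
proof -
  obtain C D where C: "circuit C" "circuit D" "C \<noteq> D" and line: "tutte_line (C \<union> D)"
    and indep: "indep (sym_diff C D)"
    using assms binary_matroid_if_line_sym_diff_dependent by blast
  have "C \<inter> D \<noteq> {}"
  proof
    assume "C \<inter> D = {}"
    then have "C \<subseteq> sym_diff C D" by blast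
    then show False using circuit_not_subset_indep[OF C(1) indep] by contradiction
  qed
  then obtain x where x: "x \<in> C \<inter> D" by blast
  obtain X where X: "circuit X" "X \<subseteq> C \<union> D - {x}"
    using circuit_elimination[OF C x] .
  obtain y where y: "y \<in> X" "y \<in> C \<inter> D"
    using circuit_not_subset_indep[OF X(1) indep] X(2) by blast
  obtain Y where Y: "circuit Y" "Y \<subseteq> C \<union> D - {y}"
    using circuit_elimination[OF C y(2)] .
  show ?thesis
  proof (rule that[OF line])
    show "{C, D, X, Y} \<subseteq> circuits_in (C \<union> D)" using C X Y by (auto simp: circuits_in_def)
    show "distinct [C, D, X, Y]" using C(3) X(2) Y(2) x y by auto
  qed
qed

section \<open>Ears\<close>

definition doubly_covered :: "'a set \<Rightarrow> bool" where
  "doubly_covered L \<longleftrightarrow> (\<forall>p\<in>L. \<exists>C\<in>circuits_in L. \<exists>D\<in>circuits_in L. C \<noteq> D \<and> p \<in> C \<inter> D)"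

lemma doubly_coveredE:
  assumes "doubly_covered L" "p \<in> L"
  obtains C D where "C \<in> circuits_in L" "D \<in> circuits_in L" "C \<noteq> D" "p \<in> C" "p \<in> D"
  using assms unfolding doubly_covered_def by blast

lemma doubly_covered_if_three_circuits:
  assumes "tutte_line L" "{C1, C2, C3} \<subseteq> circuits_in L" "distinct [C1, C2, C3]"
  shows "doubly_covered L"
  unfolding doubly_covered_def
proof
  fix p assume "p \<in> L"
  have "C1 \<union> C2 = L" "C1 \<union> C3 = L" "C2 \<union> C3 = L"
    using tutte_line_Un[OF assms(1)] assms(2,3) by simp_all
  then consider "p \<in> C1 \<inter> C2" | "p \<in> C1 \<inter> C3" | "p \<in> C2 \<inter> C3" using \<open>p \<in> L\<close> by blast
  then show "\<exists>C\<in>circuits_in L. \<exists>D\<in>circuits_in L. C \<noteq> D \<and> p \<in> C \<inter> D"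
    using assms(2,3) by cases auto
qed

text \<open>The minimality clause says that \<open>C - L\<close> is a circuit of the contraction by \<open>L\<close>.\<close>

definition ear :: "'a set \<Rightarrow> 'a set \<Rightarrow> bool" where
  "ear L C \<longleftrightarrow> circuit C \<and> C \<inter> L \<noteq> {} \<and> \<not> C \<subseteq> L \<and>
    (\<forall>D\<in>circuits_in (L \<union> C). D \<subseteq> L \<or> C - L \<subseteq> D)"

lemma connected_ear:
  assumes connected: "connected_matroid E indep" and L: "L \<subseteq> E" "L \<noteq> {}" and e: "e \<in> E - L"
  obtains C where "ear L C" "e \<in> C"
proof -
  let ?Q = "\<lambda>C. circuit C \<and> e \<in> C \<and> C \<inter> L \<noteq> {}"
  obtain p where "p \<in> L" "p \<in> E" "p \<noteq> e" using L e by blast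
  then obtain C0 where "?Q C0"
    using connected e unfolding connected_matroid_def by blast
  then obtain C where C: "?Q C" and least: "\<And>D. ?Q D \<Longrightarrow> card (C - L) \<le> card (D - L)"
    using ex_has_least_nat[of ?Q C0 "\<lambda>C. card (C - L)"] by blast
  have minimal: "\<not> D - L \<subset> C - L" if "?Q D" for D
    using least[OF that] psubset_card_mono[of "C - L" "D - L"] circuit_finite[of C] C
    by (meson finite_Diff not_le)
  have "D \<subseteq> L \<or> C - L \<subseteq> D" if D: "circuit D" "D \<subseteq> L \<union> C" for D
  proof (rule ccontr)
    assume outside: "\<not> ?thesis"
    then obtain a where a: "a \<in> C \<inter> D" "a \<notin> L" using D(2) by blast
    have "D - L \<subset> C - L" using D(2) outside by blast
    moreover have "D \<inter> L \<noteq> {}"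
    proof
      assume "D \<inter> L = {}"
      then have "D \<subseteq> C" using D(2) by blast
      then show False using circuit_subset_eq[OF D(1)] C outside by blast
    qed
    ultimately have "e \<in> C - D" using minimal D(1) C by blast
    then obtain X where X: "circuit X" "X \<subseteq> C \<union> D - {a}" "e \<in> X"
      using strong_circuit_elimination[OF _ D(1) a(1)] C by blast
    then have "X - L \<subset> C - L" using a D(2) by blast
    then have "X \<subset> C" using minimal[of X] X by blast
    then show False using circuit_subset_eq[OF X(1)] C by blast
  qed
  then have "ear L C" using C e by (auto simp: ear_def circuits_in_def)
  then show ?thesis using that C by blast
qed

definition circuits_through_ear :: "'a set \<Rightarrow> 'a set \<Rightarrow> 'a set set" where
  "circuits_through_ear L C = {B \<in> circuits_in (L \<union> C). C - L \<subseteq> B}"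

lemma circuits_through_earD:
  assumes "B \<in> circuits_through_ear L C"
  shows "circuit B" "B \<subseteq> L \<union> C" "C - L \<subseteq> B"
  using assms by (auto simp: circuits_through_ear_def circuits_in_def)

lemma ear_in_circuits_through_ear: "ear L C \<Longrightarrow> C \<in> circuits_through_ear L C"
  by (auto simp: ear_def circuits_through_ear_def circuits_in_def)

lemma circuit_through_ear_elimination:
  assumes C: "ear L C" and K: "K \<in> circuits_through_ear L C" and D: "D \<in> circuits_in L"
    and q: "q \<in> K" "q \<in> D"
  obtains B where "B \<in> circuits_through_ear L C" "B \<subseteq> K \<union> D - {q}"
proof -
  note K = circuits_through_earD[OF K]
  have D: "circuit D" "D \<subseteq> L" using D by (auto simp: circuits_in_def)
  obtain a where a: "a \<in> C - L" using C by (auto simp: ear_def)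
  then have "a \<in> K - D" using K(3) D(2) by blast
  then obtain B where B: "circuit B" "B \<subseteq> K \<union> D - {q}" "a \<in> B"
    using strong_circuit_elimination[OF K(1) D(1)] q by blast
  then have "B \<in> circuits_in (L \<union> C)" using K(2) D(2) by (auto simp: circuits_in_def)
  moreover from this have "C - L \<subseteq> B" using C a B(3) by (auto simp: ear_def)
  ultimately show ?thesis using that B(2) by (simp add: circuits_through_ear_def)
qed

lemma ear_elimination:
  assumes C: "ear L C"
    and B: "B \<in> circuits_through_ear L C" and K: "K \<in> circuits_through_ear L C" and ne: "B \<noteq> K"
  obtains X where "X \<in> circuits_in L" "X \<subseteq> B \<union> K"
proof -
  note B = circuits_through_earD[OF B] and K = circuits_through_earD[OF K]
  obtain a where a: "a \<in> C - L" using C by (auto simp: ear_def)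
  then have "a \<in> B \<inter> K" using B(3) K(3) by blast
  then obtain X where X: "circuit X" "X \<subseteq> B \<union> K - {a}"
    using circuit_elimination[OF B(1) K(1) ne] by blast
  then have "X \<in> circuits_in (L \<union> C)" using B(2) K(2) by (auto simp: circuits_in_def)
  then have "X \<subseteq> L" using C a X(2) unfolding ear_def by blast
  then have "X \<in> circuits_in L" using X(1) by (simp add: circuits_in_def)
  then show ?thesis using that X(2) by blast
qed

lemma second_circuit_through_ear:
  assumes L: "doubly_covered L" and C: "ear L C"
  obtains B where "B \<in> circuits_through_ear L C" "B \<noteq> C"
proof -
  obtain p where p: "p \<in> C" "p \<in> L" using C unfolding ear_def by blast
  obtain D where "D \<in> circuits_in L" "p \<in> D" using doubly_coveredE[OF L p(2)] .
  then obtain B where "B \<in> circuits_through_ear L C" "B \<subseteq> C \<union> D - {p}"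
    using circuit_through_ear_elimination[OF C ear_in_circuits_through_ear[OF C] _ p(1)] by blast
  then show ?thesis using that p(1) by blast
qed

text \<open>If \<open>B\<close> and \<open>K\<close> were the only circuits through the ear, elimination would force every circuit
  of \<open>L\<close> through a fixed \<open>p \<in> K - B\<close> to equal \<open>(B \<union> K) \<inter> L\<close>.\<close>

lemma third_circuit_through_ear:
  assumes L: "doubly_covered L" and C: "ear L C"
    and B: "B \<in> circuits_through_ear L C" and K: "K \<in> circuits_through_ear L C" and ne: "B \<noteq> K"
  shows "\<exists>B'\<in>circuits_through_ear L C. B' \<noteq> B \<and> B' \<noteq> K"
proof (rule ccontr)
  assume "\<not> ?thesis"
  then have only: "B' = B \<or> B' = K" if "B' \<in> circuits_through_ear L C" for B'
    using that by blast
  have elim_B: "K \<subseteq> B \<union> Y" if "Y \<in> circuits_in L" "q \<in> B" "q \<in> Y" for Y q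
    using circuit_through_ear_elimination[OF C B that] only that(2) by blast
  have elim_K: "B \<subseteq> K \<union> Y" if "Y \<in> circuits_in L" "q \<in> K" "q \<in> Y" for Y q
    using circuit_through_ear_elimination[OF C K that] only that(2) by blast
  have disjoint: "B \<inter> K \<inter> L = {}"
  proof (rule ccontr)
    assume "B \<inter> K \<inter> L \<noteq> {}"
    then obtain q where q: "q \<in> B" "q \<in> K" "q \<in> L" by blast
    obtain Y where Y: "Y \<in> circuits_in L" "q \<in> Y" using doubly_coveredE[OF L q(3)] .
    show False using circuit_through_ear_elimination[OF C K Y(1) q(2) Y(2)] only q(1,2) by blast
  qed
  obtain X where X: "X \<in> circuits_in L" "X \<subseteq> B \<union> K"
    using ear_elimination[OF C B K ne] .
  have "\<not> B \<subseteq> K" "\<not> K \<subseteq> B" using circuit_subset_eq circuits_through_earD(1) B K ne by blast+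
  then obtain q p where q: "q \<in> B" "q \<notin> K" and p: "p \<in> K" "p \<notin> B" by blast
  have through_p: "X = Y" if Y: "Y \<in> circuits_in L" "p \<in> Y" for Y
  proof -
    have "B \<subseteq> K \<union> Y" using elim_K[OF Y(1) p(1) Y(2)] .
    moreover from this have "K \<subseteq> B \<union> Y" using elim_B[OF Y(1) q(1)] q by blast
    moreover have "X \<subseteq> L" using X(1) by (simp add: circuits_in_def)
    ultimately have "X \<subseteq> Y" using X(2) disjoint by blast
    then show ?thesis using circuit_subset_eq X(1) Y(1) by (simp add: circuits_in_def)
  qed
  have "p \<in> L" using p circuits_through_earD(2)[OF K] circuits_through_earD(3)[OF B] by blast
  then obtain D D' where "D \<in> circuits_in L" "D' \<in> circuits_in L" "D \<noteq> D'" "p \<in> D" "p \<in> D'"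
    using doubly_coveredE[OF L] by blast
  then show False using through_p by metis
qed

end

section \<open>Homomorphisms to binary matroids\<close>

locale hom_to_binary_matroid = M: matroid E indep + N: matroid E' indep'
  for E :: "'a set" and indep :: "'a set \<Rightarrow> bool"
    and E' :: "'b set" and indep' :: "'b set \<Rightarrow> bool" +
  fixes f :: "'a \<Rightarrow> 'b"
  assumes hom: "matroid_hom f E indep E' indep'"
    and binary: "binary_matroid E' indep'"
begin

lemma image_circuit: "M.circuit C \<Longrightarrow> N.circuit (f ` C)"
  using hom by (simp add: matroid_hom_def)

lemma image_eq_if_subset_circuit:
  assumes "N.circuit (f ` L)" "C \<in> M.circuits_in L"
  shows "f ` C = f ` L"
  using assms N.circuit_subset_eq[OF image_circuit assms(1)]
  by (simp add: M.circuits_in_def image_mono)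

lemma image_line_circuit:
  assumes L: "M.tutte_line L"
    and Cs: "{C1, C2, C3, C4} \<subseteq> M.circuits_in L" "distinct [C1, C2, C3, C4]"
  shows "N.circuit (f ` L)"
proof (rule ccontr)
  assume not_circuit: "\<not> N.circuit (f ` L)"
  have circuit: "N.circuit (f ` C)" if "C \<in> {C1, C2, C3, C4}" for C
    using Cs(1) that image_circuit by (auto simp: M.circuits_in_def)
  have cover: "f ` C \<union> f ` D = f ` L"
    if "C \<in> {C1, C2, C3, C4}" "D \<in> {C1, C2, C3, C4}" "C \<noteq> D" for C D
    using M.tutte_line_Un[OF L] Cs(1) that by (metis image_Un subsetD)
  have not_subset: "\<not> f ` C \<subseteq> f ` D"
    if "C \<in> {C1, C2, C3, C4}" "D \<in> {C1, C2, C3, C4}" "C \<noteq> D" for C D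
    using cover[OF that] circuit[OF that(2)] not_circuit by (metis sup.absorb2)
  have covers: "f ` C1 \<union> f ` C2 = f ` L" "f ` C1 \<union> f ` C3 = f ` L" "f ` C2 \<union> f ` C3 = f ` L"
    "f ` C1 \<union> f ` C4 = f ` L" "f ` C2 \<union> f ` C4 = f ` L"
    using cover Cs(2) by simp_all
  have "f ` C3 \<subseteq> f ` C1 \<or> f ` C3 \<subseteq> f ` C4"
  proof (rule N.binary_circuit_covered[OF binary])
    show "sym_diff (f ` C1) (f ` C2) \<subseteq> f ` C3" using covers(1-3) by blast
    show "f ` C3 \<subseteq> f ` C1 \<union> f ` C2" "f ` C3 \<subseteq> f ` C1 \<union> f ` C4" "f ` C3 \<subseteq> f ` C2 \<union> f ` C4"
      unfolding covers using covers(2) by blast+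
  qed (simp_all add: circuit)
  moreover have "C3 \<noteq> C1" "C3 \<noteq> C4" using Cs(2) by auto
  ultimately show False using not_subset[of C3 C1] not_subset[of C3 C4] by blast
qed

lemma image_ear_subset:
  assumes circuit: "N.circuit (f ` L)" and L: "M.doubly_covered L" and C: "M.ear L C"
  shows "f ` C \<subseteq> f ` L"
proof (rule ccontr)
  assume "\<not> ?thesis"
  then obtain e where e: "e \<in> C" "f e \<notin> f ` L" by blast
  let ?T = "M.circuits_through_ear L C"
  have cover: "f ` L \<subseteq> f ` X \<union> f ` Y" if XY: "X \<in> ?T" "Y \<in> ?T" "X \<noteq> Y" for X Y
  proof -
    obtain Z where Z: "Z \<in> M.circuits_in L" "Z \<subseteq> X \<union> Y"
      using M.ear_elimination[OF C XY] .
    then show ?thesis using image_eq_if_subset_circuit[OF circuit Z(1)] by blast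
  qed
  have not_subset: "\<not> f ` L \<subseteq> f ` X" if "X \<in> ?T" for X
  proof
    note X = M.circuits_through_earD[OF that]
    assume "f ` L \<subseteq> f ` X"
    then have "f ` L = f ` X" using N.circuit_subset_eq circuit image_circuit[OF X(1)] by blast
    then show False using e X(3) by blast
  qed
  have C_through: "C \<in> ?T" using M.ear_in_circuits_through_ear[OF C] .
  obtain X where X: "X \<in> ?T" "X \<noteq> C" using M.second_circuit_through_ear[OF L C] .
  obtain Y where Y: "Y \<in> ?T" "Y \<noteq> X" "Y \<noteq> C"
    using M.third_circuit_through_ear[OF L C X(1) C_through X(2)] by blast
  have "f ` L \<subseteq> f ` X \<or> f ` L \<subseteq> f ` Y"
  proof (rule N.binary_circuit_covered[OF binary circuit])
    show "sym_diff (f ` X) (f ` C) \<subseteq> f ` L"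
      using M.circuits_through_earD[OF X(1)] by blast
    show "f ` L \<subseteq> f ` X \<union> f ` C" "f ` L \<subseteq> f ` X \<union> f ` Y" "f ` L \<subseteq> f ` C \<union> f ` Y"
      using cover X Y C_through by metis+
  qed (use X(1) C_through M.circuits_through_earD(1) image_circuit in metis)+
  then show False using not_subset X(1) Y(1) by blast
qed

end

theorem theorem4:
  fixes EM :: "'a set" and indepM :: "'a set \<Rightarrow> bool"
    and EN :: "'b set" and indepN :: "'b set \<Rightarrow> bool"
    and f :: "'a \<Rightarrow> 'b"
  assumes "matroid EM indepM" and "connected_matroid EM indepM"
    and "matroid EN indepN" and "binary_matroid EN indepN"
    and "EN \<notin> circuits EN indepN"
    and "matroid_hom f EM indepM EN indepN"
  shows "binary_matroid EM indepM"
proof (rule ccontr)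
  interpret hom_to_binary_matroid EM indepM EN indepN f
    using assms by (intro hom_to_binary_matroid.intro hom_to_binary_matroid_axioms.intro)
  assume "\<not> binary_matroid EM indepM"
  then obtain L C1 C2 C3 C4 where line: "M.tutte_line L"
    and circuits: "{C1, C2, C3, C4} \<subseteq> M.circuits_in L" "distinct [C1, C2, C3, C4]"
    by (rule M.nonbinary_line_four_circuits)
  have image: "N.circuit (f ` L)" using image_line_circuit[OF line circuits] .
  have doubly_covered: "M.doubly_covered L"
    using M.doubly_covered_if_three_circuits[OF line, of C1 C2 C3] circuits by simp
  have L: "L \<subseteq> EM" "L \<noteq> {}"
    using M.tutte_line_subset_ground[OF line] N.circuit_nonempty[OF image] by auto
  have "f e \<in> f ` L" if e: "e \<in> EM" for e
  proof (cases "e \<in> L")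
    case False
    then obtain C where C: "M.ear L C" "e \<in> C"
      using M.connected_ear[OF assms(2) L] e by blast
    then show ?thesis using image_ear_subset[OF image doubly_covered C(1)] by blast
  qed blast
  then have "f ` L = EN" using hom L(1) by (auto simp: matroid_hom_def)
  then show False using image assms(5) by simp
qed

end
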